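(* Let $X$ be a real normed linear space and let $x\in X$. Then the following are equivalent: (a) $x$ is a right-symmetric point in $X$. (b) For every $y\in X$, $\rho_+(y,x)\geq 0$ implies $\rho_+(x,y)\geq 0$. (c) For every $y\in X$, $\rho_-(y,x)\leq 0$ implies $\rho_-(x,y)\leq 0$.
   Context: For $x,y$ in a real normed linear space $X$, $\rho_{\pm}(x,y)=\lim_{\lambda\to 0^{\pm}}\frac{\|x+\lambda y\|-\|x\|}{\lambda}$. Birkhoff-James orthogonality: $x\perp_B y$ means $\|x+\lambda y\|\geq\|x\|$ for all $\lambda\in\mathbb{R}$. An element $x\in X$ is right-symmetric if for every $y\in X$, $y\perp_B x$ implies $x\perp_B y$. *)

theory Defs
  imports Complex_Main
begin

text \<open>
  One-sided directional derivatives of the norm. The difference quotient is monotone in \<open>t\<close>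
  (by convexity of the norm) and bounded in absolute value by \<open>norm y\<close>, so both limits always
  exist and \<open>Lim\<close> denotes a genuine limit.
\<close>

definition rho_plus :: "'a::real_normed_vector \<Rightarrow> 'a \<Rightarrow> real" where
  "rho_plus x y = Lim (at_right 0) (\<lambda>t::real. (norm (x + t *\<^sub>R y) - norm x) / t)"

definition rho_minus :: "'a::real_normed_vector \<Rightarrow> 'a \<Rightarrow> real" where
  "rho_minus x y = Lim (at_left 0) (\<lambda>t::real. (norm (x + t *\<^sub>R y) - norm x) / t)"

definition birkhoff_orthogonal :: "'a::real_normed_vector \<Rightarrow> 'a \<Rightarrow> bool"
    (infix "\<bottom>\<^sub>B" 50) where
  "x \<bottom>\<^sub>B y \<longleftrightarrow> (\<forall>t::real. norm (x + t *\<^sub>R y) \<ge> norm x)"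

definition right_symmetric :: "'a::real_normed_vector \<Rightarrow> bool" where
  "right_symmetric x \<longleftrightarrow> (\<forall>y. y \<bottom>\<^sub>B x \<longrightarrow> x \<bottom>\<^sub>B y)"

end

theory Submission
  imports Defs "HOL-Analysis.Elementary_Topology"
begin

text \<open>
  Convexity of the norm makes the difference quotient of \<open>t \<mapsto> norm (x + t *\<^sub>R y)\<close> monotone, so
  \<open>rho_plus x y\<close> is its infimum over \<open>t > 0\<close>. Hence \<open>rho_plus x y \<ge> 0\<close> says exactly that moving from
  \<open>x\<close> in the direction \<open>y\<close> never shortens the vector (\<open>rho_plus_nonneg_iff\<close>), and
  \<open>rho_minus x y \<le> 0\<close> says the same for the direction \<open>- y\<close> (\<open>rho_minus_nonpos_iff\<close>). Birkhoff-James
  orthogonality is the conjunction of these two one-sided conditions. All three statements of the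
  theorem are thereby about the relation ``\<open>norm (x + t *\<^sub>R y) \<ge> norm x\<close> for all \<open>t \<ge> 0\<close>'', which is
  invariant under changing the signs of both \<open>x\<close> and \<open>y\<close>.

  That invariance gives the equivalence of (b) and (c), and the implication from (b) to (a).
  The substance is in (a) implies (b). If \<open>x \<noteq> 0\<close> and \<open>y\<close> is not shortened in the
  direction \<open>x\<close>, then the least norm on the line \<open>y + t *\<^sub>R x\<close> is attained at some \<open>t = s \<le> 0\<close>
  (\<open>birkhoff_orthogonal_on_backward_ray\<close>). This vector \<open>z = y + s *\<^sub>R x\<close> is orthogonal to \<open>x\<close>, so right
  symmetry makes \<open>x\<close> orthogonal to \<open>z\<close>. Finally \<open>y = z + (- s) *\<^sub>R x\<close> differs from \<open>z\<close> by a
  nonnegative multiple of \<open>x\<close>, and adding such a multiple to the direction of motion keeps \<open>x\<close> from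
  being shortened (\<open>rho_plus_add_multiple_nonneg\<close>).
\<close>

text \<open>
  Points \<open>x + s *\<^sub>R y\<close> with \<open>0 < s \<le> t\<close> are convex combinations of \<open>x\<close> and \<open>x + t *\<^sub>R y\<close>, so this is
  the statement that chords of a convex function have increasing slope.
\<close>
lemma norm_quotient_mono:
  fixes x y :: "'a::real_normed_vector"
  assumes "0 < s" "s \<le> t"
  shows "(norm (x + s *\<^sub>R y) - norm x) / s \<le> (norm (x + t *\<^sub>R y) - norm x) / t"
proof -
  have "t *\<^sub>R (x + s *\<^sub>R y) = (t - s) *\<^sub>R x + s *\<^sub>R (x + t *\<^sub>R y)"
    by (simp add: algebra_simps)
  then have "norm (t *\<^sub>R (x + s *\<^sub>R y)) \<le> norm ((t - s) *\<^sub>R x) + norm (s *\<^sub>R (x + t *\<^sub>R y))"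
    by (metis norm_triangle_ineq)
  then have "t * norm (x + s *\<^sub>R y) \<le> (t - s) * norm x + s * norm (x + t *\<^sub>R y)"
    using assms by simp
  then show ?thesis
    using assms by (simp add: field_simps)
qed

lemma norm_quotient_lower_bound:
  fixes x y :: "'a::real_normed_vector"
  assumes "0 < t"
  shows "- norm y \<le> (norm (x + t *\<^sub>R y) - norm x) / t"
proof -
  have "norm x - norm (t *\<^sub>R y) \<le> norm (x + t *\<^sub>R y)"
    by (rule norm_diff_ineq)
  then show ?thesis
    using assms by (simp add: field_simps)
qed

lemma norm_quotient_tendsto_Inf:
  fixes x y :: "'a::real_normed_vector"
  shows "((\<lambda>t. (norm (x + t *\<^sub>R y) - norm x) / t) \<longlongrightarrow>
      (INF t\<in>{0<..}. (norm (x + t *\<^sub>R y) - norm x) / t)) (at_right 0)"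
  using Lim_right_bound[of UNIV 0 "\<lambda>t. (norm (x + t *\<^sub>R y) - norm x) / t" "- norm y"]
  by (simp add: norm_quotient_mono norm_quotient_lower_bound)

lemma rho_plus_eq_Inf:
  fixes x y :: "'a::real_normed_vector"
  shows "rho_plus x y = (INF t\<in>{0<..}. (norm (x + t *\<^sub>R y) - norm x) / t)"
  unfolding rho_plus_def by (intro tendsto_Lim norm_quotient_tendsto_Inf) simp

lemma rho_plus_nonneg_iff:
  fixes x y :: "'a::real_normed_vector"
  shows "rho_plus x y \<ge> 0 \<longleftrightarrow> (\<forall>t\<ge>0. norm (x + t *\<^sub>R y) \<ge> norm x)"
proof
  assume nonneg: "rho_plus x y \<ge> 0"
  have bdd: "bdd_below ((\<lambda>t. (norm (x + t *\<^sub>R y) - norm x) / t) ` {0<..})"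
    by (rule bdd_belowI2[where m = "- norm y"]) (simp add: norm_quotient_lower_bound)
  show "\<forall>t\<ge>0. norm (x + t *\<^sub>R y) \<ge> norm x"
  proof (intro allI impI)
    fix t :: real
    assume "t \<ge> 0"
    show "norm (x + t *\<^sub>R y) \<ge> norm x"
    proof (cases "t = 0")
      case False
      with \<open>t \<ge> 0\<close> have "t > 0" by simp
      then have "rho_plus x y \<le> (norm (x + t *\<^sub>R y) - norm x) / t"
        unfolding rho_plus_eq_Inf using bdd by (intro cINF_lower) auto
      with nonneg have "0 \<le> (norm (x + t *\<^sub>R y) - norm x) / t" by linarith
      with \<open>t > 0\<close> show ?thesis by (simp add: zero_le_divide_iff)
    qed simp
  qed
next
  assume "\<forall>t\<ge>0. norm (x + t *\<^sub>R y) \<ge> norm x"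
  then show "rho_plus x y \<ge> 0"
    unfolding rho_plus_eq_Inf by (intro cINF_greatest) auto
qed

lemma rho_minus_eq_uminus_rho_plus:
  fixes x y :: "'a::real_normed_vector"
  shows "rho_minus x y = - rho_plus x (- y)"
proof -
  let ?q = "\<lambda>t. (norm (x + t *\<^sub>R (- y)) - norm x) / t"
  have "(?q \<longlongrightarrow> rho_plus x (- y)) (at_right 0)"
    unfolding rho_plus_eq_Inf by (rule norm_quotient_tendsto_Inf)
  then have "((\<lambda>t. - ?q t) \<longlongrightarrow> - rho_plus x (- y)) (at_right 0)"
    by (rule tendsto_minus)
  then have "((\<lambda>t. (norm (x + t *\<^sub>R y) - norm x) / t) \<longlongrightarrow> - rho_plus x (- y)) (at_left 0)"
    by (simp add: filterlim_at_left_to_right)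
  then show ?thesis
    unfolding rho_minus_def by (intro tendsto_Lim) auto
qed

lemma rho_minus_nonpos_iff:
  fixes x y :: "'a::real_normed_vector"
  shows "rho_minus x y \<le> 0 \<longleftrightarrow> rho_plus x (- y) \<ge> 0"
  by (simp add: rho_minus_eq_uminus_rho_plus)

lemma rho_plus_minus_minus_nonneg_iff:
  fixes x y :: "'a::real_normed_vector"
  shows "rho_plus (- x) (- y) \<ge> 0 \<longleftrightarrow> rho_plus x y \<ge> 0"
proof -
  have "norm (- x + t *\<^sub>R (- y)) = norm (x + t *\<^sub>R y)" for t
    using norm_minus_cancel[of "x + t *\<^sub>R y"] by simp
  then show ?thesis
    by (simp add: rho_plus_nonneg_iff)
qed

lemma birkhoff_orthogonal_iff_rho_plus:
  fixes x y :: "'a::real_normed_vector"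
  shows "x \<bottom>\<^sub>B y \<longleftrightarrow> rho_plus x y \<ge> 0 \<and> rho_plus x (- y) \<ge> 0"
proof
  assume "x \<bottom>\<^sub>B y"
  then have "norm (x + t *\<^sub>R y) \<ge> norm x" for t
    by (simp add: birkhoff_orthogonal_def)
  from this this[of "- t" for t] show "rho_plus x y \<ge> 0 \<and> rho_plus x (- y) \<ge> 0"
    by (simp add: rho_plus_nonneg_iff)
next
  assume nonneg: "rho_plus x y \<ge> 0 \<and> rho_plus x (- y) \<ge> 0"
  have "norm (x + t *\<^sub>R y) \<ge> norm x" for t
  proof (cases "t \<ge> 0")
    case True
    with nonneg show ?thesis by (simp add: rho_plus_nonneg_iff)
  next
    case False
    then have "norm (x + (- t) *\<^sub>R (- y)) \<ge> norm x"
      using nonneg unfolding rho_plus_nonneg_iff by (meson le_minus_iff linear neg_0_le_iff_le)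
    then show ?thesis by simp
  qed
  then show "x \<bottom>\<^sub>B y"
    by (simp add: birkhoff_orthogonal_def)
qed

text \<open>
  The norm on the line \<open>y + t *\<^sub>R x\<close> is continuous and tends to infinity as \<open>x \<noteq> 0\<close>, so it attains its
  minimum. Since \<open>rho_plus y x \<ge> 0\<close>, no point with \<open>t > 0\<close> does better than \<open>t = 0\<close>, so a minimizer
  can be chosen with \<open>t \<le> 0\<close>; and a vector of least norm on the line is orthogonal to \<open>x\<close>.
\<close>
lemma birkhoff_orthogonal_on_backward_ray:
  fixes x y :: "'a::real_normed_vector"
  assumes "x \<noteq> 0" and "rho_plus y x \<ge> 0"
  obtains s where "s \<le> 0" and "(y + s *\<^sub>R x) \<bottom>\<^sub>B x"
proof -
  \<comment> \<open>Left of \<open>- R\<close> the reverse triangle inequality keeps the norm above its value at \<open>0\<close>.\<close>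
  define R where "R = 2 * norm y / norm x"
  have "R \<ge> 0" by (simp add: R_def)
  have "continuous_on {- R..0} (\<lambda>t. norm (y + t *\<^sub>R x))"
    by (intro continuous_intros)
  with \<open>R \<ge> 0\<close> obtain s where s: "s \<in> {- R..0}"
    and min: "\<forall>t\<in>{- R..0}. norm (y + s *\<^sub>R x) \<le> norm (y + t *\<^sub>R x)"
    using continuous_attains_inf[of "{- R..0}" "\<lambda>t. norm (y + t *\<^sub>R x)"] by auto
  have at_0: "norm (y + s *\<^sub>R x) \<le> norm y"
    using min[rule_format, of 0] \<open>R \<ge> 0\<close> by simp
  have global_min: "norm (y + s *\<^sub>R x) \<le> norm (y + t *\<^sub>R x)" for t
  proof -
    consider "t \<in> {- R..0}" | "t > 0" | "t < - R" by fastforce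
    then show ?thesis
    proof cases
      case 1
      with min show ?thesis by blast
    next
      case 2
      with assms(2) have "norm y \<le> norm (y + t *\<^sub>R x)"
        by (simp add: rho_plus_nonneg_iff)
      with at_0 show ?thesis by linarith
    next
      case 3
      with \<open>R \<ge> 0\<close> have "R * norm x \<le> \<bar>t\<bar> * norm x"
        by (intro mult_right_mono) auto
      then have "2 * norm y \<le> norm (t *\<^sub>R x)"
        using \<open>x \<noteq> 0\<close> by (simp add: R_def)
      moreover have "norm (t *\<^sub>R x) - norm y \<le> norm (y + t *\<^sub>R x)"
        using norm_diff_ineq[of "t *\<^sub>R x" y] by (simp add: add.commute)
      ultimately show ?thesis
        using at_0 by linarith
    qed
  qed
  have "(y + s *\<^sub>R x) \<bottom>\<^sub>B x"
    unfolding birkhoff_orthogonal_def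
  proof
    fix t :: real
    show "norm (y + s *\<^sub>R x) \<le> norm (y + s *\<^sub>R x + t *\<^sub>R x)"
      using global_min[of "s + t"] by (simp add: algebra_simps)
  qed
  with s show thesis
    by (intro that[of s]) auto
qed

text \<open>
  Adding \<open>c *\<^sub>R x\<close> to the direction rescales: \<open>x + t *\<^sub>R (z + c *\<^sub>R x)\<close> is \<open>1 + t * c \<ge> 1\<close> times a point of
  the ray from \<open>x\<close> in the direction \<open>z\<close>.
\<close>
lemma rho_plus_add_multiple_nonneg:
  fixes x z :: "'a::real_normed_vector"
  assumes "rho_plus x z \<ge> 0" and "c \<ge> 0"
  shows "rho_plus x (z + c *\<^sub>R x) \<ge> 0"
  unfolding rho_plus_nonneg_iff
proof (intro allI impI)
  fix t :: real
  assume "t \<ge> 0"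
  define k where "k = 1 + t * c"
  have "k \<ge> 1"
    using \<open>t \<ge> 0\<close> \<open>c \<ge> 0\<close> by (simp add: k_def)
  have "x + t *\<^sub>R (z + c *\<^sub>R x) = k *\<^sub>R x + t *\<^sub>R z"
    by (simp add: k_def algebra_simps)
  also have "\<dots> = k *\<^sub>R (x + (t / k) *\<^sub>R z)"
    using \<open>k \<ge> 1\<close> by (simp add: scaleR_add_right)
  finally have eq: "norm (x + t *\<^sub>R (z + c *\<^sub>R x)) = k * norm (x + (t / k) *\<^sub>R z)"
    using \<open>k \<ge> 1\<close> by simp
  have "norm x \<le> norm (x + (t / k) *\<^sub>R z)"
    using assms(1) \<open>t \<ge> 0\<close> \<open>k \<ge> 1\<close> by (simp add: rho_plus_nonneg_iff)
  also have "\<dots> \<le> k * norm (x + (t / k) *\<^sub>R z)"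
    using \<open>k \<ge> 1\<close> by (simp add: mult_le_cancel_right1)
  finally show "norm x \<le> norm (x + t *\<^sub>R (z + c *\<^sub>R x))"
    by (simp add: eq)
qed

lemma right_symmetric_imp_rho_plus_nonneg:
  fixes x y :: "'a::real_normed_vector"
  assumes "right_symmetric x" and "rho_plus y x \<ge> 0"
  shows "rho_plus x y \<ge> 0"
proof (cases "x = 0")
  case True
  then show ?thesis by (simp add: rho_plus_nonneg_iff)
next
  case False
  then obtain s where s: "s \<le> 0" and "(y + s *\<^sub>R x) \<bottom>\<^sub>B x"
    using birkhoff_orthogonal_on_backward_ray assms(2) by blast
  then have "x \<bottom>\<^sub>B (y + s *\<^sub>R x)"
    using assms(1) by (simp add: right_symmetric_def)
  then have "rho_plus x (y + s *\<^sub>R x) \<ge> 0"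
    by (simp add: birkhoff_orthogonal_iff_rho_plus)
  then have "rho_plus x (y + s *\<^sub>R x + (- s) *\<^sub>R x) \<ge> 0"
    by (rule rho_plus_add_multiple_nonneg) (use s in simp)
  then show ?thesis by simp
qed

lemma right_symmetric_iff_rho_plus:
  fixes x :: "'a::real_normed_vector"
  shows "right_symmetric x \<longleftrightarrow> (\<forall>y. rho_plus y x \<ge> 0 \<longrightarrow> rho_plus x y \<ge> 0)"
proof
  assume "right_symmetric x"
  then show "\<forall>y. rho_plus y x \<ge> 0 \<longrightarrow> rho_plus x y \<ge> 0"
    by (blast intro: right_symmetric_imp_rho_plus_nonneg)
next
  assume b: "\<forall>y. rho_plus y x \<ge> 0 \<longrightarrow> rho_plus x y \<ge> 0"
  show "right_symmetric x"
    unfolding right_symmetric_def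
  proof (intro allI impI)
    fix y
    assume "y \<bottom>\<^sub>B x"
    then have "rho_plus y x \<ge> 0" and "rho_plus y (- x) \<ge> 0"
      by (simp_all add: birkhoff_orthogonal_iff_rho_plus)
    moreover from this(2) have "rho_plus (- y) x \<ge> 0"
      using rho_plus_minus_minus_nonneg_iff[of y "- x"] by simp
    ultimately show "x \<bottom>\<^sub>B y"
      using b by (simp add: birkhoff_orthogonal_iff_rho_plus)
  qed
qed

text \<open>The substitution \<open>y \<mapsto> - y\<close> turns one condition into the other, because \<open>rho_minus\<close> reverses the
  direction and the sign of \<open>rho_plus\<close> is unchanged when both arguments are negated.\<close>
lemma rho_minus_condition_iff_rho_plus_condition:
  fixes x :: "'a::real_normed_vector"
  shows "(\<forall>y. rho_minus y x \<le> 0 \<longrightarrow> rho_minus x y \<le> 0) \<longleftrightarrow>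
         (\<forall>y. rho_plus y x \<ge> 0 \<longrightarrow> rho_plus x y \<ge> 0)"
proof -
  have "rho_minus (- y) x \<le> 0 \<longleftrightarrow> rho_plus y x \<ge> 0" for y
    by (simp add: rho_minus_nonpos_iff rho_plus_minus_minus_nonneg_iff)
  moreover have "rho_minus x (- y) \<le> 0 \<longleftrightarrow> rho_plus x y \<ge> 0" for y
    by (simp add: rho_minus_nonpos_iff)
  ultimately show ?thesis
    by (metis minus_minus)
qed

theorem corollary2p2p2:
  fixes x :: "'a::real_normed_vector"
  shows "(right_symmetric x \<longleftrightarrow> (\<forall>y. rho_plus y x \<ge> 0 \<longrightarrow> rho_plus x y \<ge> 0)) \<and>
         (right_symmetric x \<longleftrightarrow> (\<forall>y. rho_minus y x \<le> 0 \<longrightarrow> rho_minus x y \<le> 0))"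
  using right_symmetric_iff_rho_plus[of x] rho_minus_condition_iff_rho_plus_condition[of x] by simp

end
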